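(* Let $\mathbf U=(D,\mathbf m^\top,\mathbf B^\top,E)^\top\in\mathcal G$ and let $\xi_c$ be the unique positive root of $$f_c(\xi)=\xi^3+(B^2-E)\xi^2-\frac{B^2D^2+\tau^2}{2}.$$ Define $\alpha_1=B^2-E$, $a_0=-\frac12(B^2D^2+\tau^2)$ and $\delta=27a_0+4\alpha_1^3$. (1) If $\delta>0$, then $$\xi_c=-\frac{\alpha_1}{3}\Big(1-2\cos\Big(\frac\theta3-\frac\pi3\Big)\Big),\qquad \theta=\arccos\Big(1+\frac{13.5\,a_0}{\alpha_1^3}\Big).$$ (2) If $\delta\le0$, then $$\xi_c=-\frac13\Big(\alpha_1+\sqrt[3]{X_1+X_2}+\sqrt[3]{X_1-X_2}\Big),\qquad X_1=\alpha_1^3+13.5\,a_0,\quad X_2=1.5\sqrt{3a_0\delta},$$ where $\sqrt[3]{\cdot}$ denotes the real cube root.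
   Context: Conservative vectors are $\mathbf U=(D,\mathbf m^\top,\mathbf B^\top,E)^\top$ with $D,E\in\mathbb R$ and $\mathbf m,\mathbf B\in\mathbb R^3$. Write $m=|\mathbf m|$, $B=|\mathbf B|$, $\tau=\mathbf m\cdot\mathbf B$. The admissible set $\mathcal G$ is the set of all $\mathbf U$ with $D>0$, $E-\sqrt{D^2+m^2}>0$ and $\Psi(\mathbf U)>0$, where $$\Phi(\mathbf U)=\sqrt{(B^2-E)^2+3(E^2-D^2-m^2)},$$ $$\Psi(\mathbf U)=\big(\Phi(\mathbf U)-2(B^2-E)\big)\sqrt{\Phi(\mathbf U)+B^2-E}-\sqrt{\tfrac{27}{2}(D^2B^2+\tau^2)}.$$ It is known that for $\mathbf U\in\mathcal G$ the polynomial $f_c$ has a unique positive root. *)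

theory Defs
  imports "HOL-Analysis.Analysis"
begin

type_synonym cons_vec = "real \<times> (real ^ 3) \<times> (real ^ 3) \<times> real"

text \<open>
  A conservative vector is a tuple (D, m, B, E).  The paper's scalars |m| and |B| are
  \<^term>\<open>norm m\<close> and \<^term>\<open>norm B\<close>, and tau is \<^term>\<open>m \<bullet> B\<close>.
\<close>

fun Phi :: "cons_vec \<Rightarrow> real" where
  "Phi (D, m, B, E) =
     sqrt (((norm B)\<^sup>2 - E)\<^sup>2 + 3 * (E\<^sup>2 - D\<^sup>2 - (norm m)\<^sup>2))"

fun Psi :: "cons_vec \<Rightarrow> real" where
  "Psi (D, m, B, E) =
     (Phi (D, m, B, E) - 2 * ((norm B)\<^sup>2 - E)) * sqrt (Phi (D, m, B, E) + (norm B)\<^sup>2 - E)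
     - sqrt (27 / 2 * (D\<^sup>2 * (norm B)\<^sup>2 + (m \<bullet> B)\<^sup>2))"

text \<open>
  The library function \<^const>\<open>sqrt\<close> is total and odd, but this plays no role for membership
  below: the condition on E makes the radicand in Phi nonnegative with Phi at least
  the absolute value of |B|^2 - E, so every radicand that occurs is nonnegative.
\<close>

definition admissible_set :: "cons_vec set" where
  "admissible_set =
     {(D, m, B, E). D > 0 \<and> E - sqrt (D\<^sup>2 + (norm m)\<^sup>2) > 0 \<and> Psi (D, m, B, E) > 0}"

fun f_c :: "cons_vec \<Rightarrow> real \<Rightarrow> real" where
  "f_c (D, m, B, E) \<xi> =
     \<xi> ^ 3 + ((norm B)\<^sup>2 - E) * \<xi>\<^sup>2 - ((norm B)\<^sup>2 * D\<^sup>2 + (m \<bullet> B)\<^sup>2) / 2"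

definition xi_c :: "cons_vec \<Rightarrow> real" where
  "xi_c U = (THE \<xi>. \<xi> > 0 \<and> f_c U \<xi> = 0)"

text \<open>The description defining \<^const>\<open>xi_c\<close> is proper on the admissible set.\<close>

lemma cubic_unique_pos_root:
  fixes a c :: real
  assumes "c > 0 \<or> (c = 0 \<and> a < 0)"
  shows "\<exists>!x. x > 0 \<and> x ^ 3 + a * x\<^sup>2 - c = 0"
proof (cases "c = 0")
  case True
  have "x ^ 3 + a * x\<^sup>2 - c = 0 \<longleftrightarrow> x = - a" if "x > 0" for x
  proof -
    have "x ^ 3 + a * x\<^sup>2 - c = x\<^sup>2 * (x + a)"
      using True by (simp add: power2_eq_square power3_eq_cube algebra_simps)
    then show ?thesis using that by auto
  qed
  then show ?thesis using assms True 
    by (intro ex1I[of _ "- a"]) (auto simp: power2_eq_square power3_eq_cube)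
next
  case False
  then have c: "c > 0" using assms by auto
  let ?f = "\<lambda>x::real. x ^ 3 + a * x\<^sup>2 - c"
  define M where "M = 1 + \<bar>a\<bar> + c"
  have M: "M \<ge> 1" "M + a \<ge> c" using c unfolding M_def by auto
  have "c \<le> M\<^sup>2 * (M + a)"
  proof -
    have "1 * c \<le> M\<^sup>2 * (M + a)"
      using M c by (intro mult_mono) auto
    then show ?thesis by simp
  qed
  then have "?f M \<ge> 0"
    by (simp add: power2_eq_square power3_eq_cube algebra_simps)
  moreover have "?f 0 \<le> 0" using c by simp
  ultimately obtain x where x: "0 \<le> x" "?f x = 0"
    using IVT'[of ?f 0 0 M] M by (force intro!: continuous_intros)
  have xpos: "x > 0" using x c by (cases "x = 0") auto
  have uniq: False if "0 < u" "u < v" "?f u = 0" "?f v = 0" for u v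
  proof -
    have 1: "u\<^sup>2 * (u + a) = c" "v\<^sup>2 * (v + a) = c"
      using that by (auto simp: power2_eq_square power3_eq_cube algebra_simps)
    have "u + a > 0" using 1 c that by (metis zero_less_mult_pos zero_less_power)
    moreover have "u\<^sup>2 < v\<^sup>2" using that by (intro power_strict_mono) auto
    ultimately have "u\<^sup>2 * (u + a) < v\<^sup>2 * (v + a)"
      using that by (intro mult_strict_mono) auto
    then show False using 1 by simp
  qed
  show ?thesis
  proof (rule ex1I[of _ x])
    show "0 < x \<and> ?f x = 0" using xpos x by simp
    show "y = x" if "0 < y \<and> ?f y = 0" for y
      using uniq[of x y] uniq[of y x] that xpos x by (meson linorder_less_linear)
  qed
qed

lemma f_c_unique_pos_root:
  assumes "U \<in> admissible_set"
  shows "\<exists>!\<xi>. \<xi> > 0 \<and> f_c U \<xi> = 0"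
proof -
  obtain D m B E where U: "U = (D, m, B, E)" by (metis prod.exhaust)
  have D: "D > 0" and "E > sqrt (D\<^sup>2 + (norm m)\<^sup>2)"
    using assms unfolding U admissible_set_def by auto
  moreover have "sqrt (D\<^sup>2 + (norm m)\<^sup>2) \<ge> 0" by simp
  ultimately have E: "E > 0" by linarith
  let ?c = "((norm B)\<^sup>2 * D\<^sup>2 + (m \<bullet> B)\<^sup>2) / 2"
  have "?c > 0 \<or> (?c = 0 \<and> (norm B)\<^sup>2 - E < 0)"
  proof (cases "B = 0")
    case True
    then show ?thesis using E by simp
  next
    case False
    then have "(norm B)\<^sup>2 * D\<^sup>2 > 0" using D by simp
    then show ?thesis by (simp add: add_pos_nonneg)
  qed
  then show ?thesis unfolding U f_c.simps by (rule cubic_unique_pos_root)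
qed

end

theory Submission
  imports Defs
begin

text \<open>
  Both formulas are the classical solutions of the cubic \<open>x\<^sup>3 + \<alpha> x\<^sup>2 + a\<close> with \<open>a \<le> 0\<close>: substituting
  \<open>x = y - \<alpha>/3\<close> gives Vieta's trigonometric solution when the discriminant is positive and
  Cardano's solution otherwise. Each is a positive root, so it is the unique one.
\<close>

text \<open>With \<open>x = y - \<alpha> / 3\<close>, the choice
  \<open>y = (2 * \<alpha> / 3) * cos \<phi>\<close> scales the depressed cubic so that the
  triple-angle formula applies. The shift by \<open>pi / 3\<close> selects the root with
  \<open>cos \<phi> > 1 / 2\<close>, which is the positive one.\<close>

lemma cubic_trigonometric_root:
  fixes \<alpha> a :: real
  assumes a: "a < 0" and \<delta>: "27 * a + 4 * \<alpha> ^ 3 > 0"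
  defines "\<phi> \<equiv> arccos (1 + 27 / 2 * a / \<alpha> ^ 3) / 3 - pi / 3"
  defines "x \<equiv> - (\<alpha> / 3) * (1 - 2 * cos \<phi>)"
  shows "x > 0 \<and> x ^ 3 + \<alpha> * x\<^sup>2 + a = 0"
proof
  define c where "c = 1 + 27 / 2 * a / \<alpha> ^ 3"
  have \<alpha>3: "\<alpha> ^ 3 > 0" using a \<delta> by linarith
  then have \<alpha>: "\<alpha> > 0" by (simp add: zero_less_power_eq)
  \<comment> \<open>The lower bound comes from \<delta>. The strict upper bound, from
    \<open>a < 0\<close>, later gives \<open>\<phi> > - (pi / 3)\<close> and hence strict positivity
    of \<open>x\<close>.\<close>
  have c: "-1 \<le> c" "c < 1"
    using a \<delta> \<alpha>3 unfolding c_def by (simp_all add: field_simps)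
  have c_\<alpha>: "(c - 1) * \<alpha> ^ 3 = 27 / 2 * a"
    using \<alpha> unfolding c_def by simp
  have \<theta>: "0 < arccos c" "arccos c \<le> pi"
    using c arccos_lt_bounded[of c] arccos_ubound[of c] arccos_less_arccos[of c 1] by auto
  have \<phi>: "- (pi / 3) < \<phi>" "\<phi> \<le> 0"
    using \<theta> unfolding \<phi>_def c_def[symmetric] by auto
  have "cos (pi / 3) < cos (- \<phi>)"
    using \<phi> by (intro cos_monotone_0_pi) auto
  then have "cos \<phi> > 1 / 2" by (simp add: cos_60)
  then show "x > 0" using \<alpha> unfolding x_def by (simp add: field_simps)
  \<comment> \<open>Tripling turns the shift \<open>pi / 3\<close> into \<open>pi\<close>, which
    flips the sign of the cosine.\<close>
  have "3 * \<phi> = arccos c - pi" unfolding \<phi>_def c_def by simp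
  then have "cos (3 * \<phi>) = - c"
    using c by (simp add: cos_diff cos_arccos)
  then have cos3: "4 * cos \<phi> ^ 3 - 3 * cos \<phi> = - c"
    unfolding cos_treble_cos .
  have "27 * (x ^ 3 + \<alpha> * x\<^sup>2 + a)
      = 2 * \<alpha> ^ 3 * ((4 * cos \<phi> ^ 3 - 3 * cos \<phi>) + 1) + 27 * a"
    unfolding x_def by (simp add: power2_eq_square power3_eq_cube field_simps)
  also have "\<dots> = 0"
    using c_\<alpha> unfolding cos3 by (simp add: algebra_simps)
  finally show "x ^ 3 + \<alpha> * x\<^sup>2 + a = 0" by simp
qed

text \<open>The two cube roots have product \<open>\<alpha>\<^sup>2\<close>, so their sum
  \<open>s\<close> satisfies \<open>s ^ 3 = 3 * \<alpha>\<^sup>2 * s + 2 * X\<close>, the depressed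
  cubic for \<open>s = -3 * y\<close>.\<close>

lemma cubic_cardano_root:
  fixes \<alpha> a :: real
  assumes a: "a < 0 \<or> (a = 0 \<and> \<alpha> < 0)" and \<delta>: "27 * a + 4 * \<alpha> ^ 3 \<le> 0"
  defines "X \<equiv> \<alpha> ^ 3 + 27 / 2 * a"
    and "Y \<equiv> 3 / 2 * sqrt (3 * a * (27 * a + 4 * \<alpha> ^ 3))"
  defines "x \<equiv> - (1 / 3) * (\<alpha> + root 3 (X + Y) + root 3 (X - Y))"
  shows "x > 0 \<and> x ^ 3 + \<alpha> * x\<^sup>2 + a = 0"
proof
  define p where "p = root 3 (X + Y)"
  define q where "q = root 3 (X - Y)"
  define s where "s = p + q"
  have p3: "p ^ 3 = X + Y" and q3: "q ^ 3 = X - Y"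
    unfolding p_def q_def by (simp_all add: odd_real_root_pow)
  have x: "x = - (1 / 3) * (\<alpha> + s)"
    unfolding x_def s_def p_def q_def by simp
  \<comment> \<open>Both factors are nonpositive, so \<open>Y\<close> is a genuine square
    root.\<close>
  have "3 * a * (27 * a + 4 * \<alpha> ^ 3) \<ge> 0"
    using a \<delta> by (intro mult_nonpos_nonpos) auto
  then have Y2: "Y\<^sup>2 = 9 / 4 * (3 * a * (27 * a + 4 * \<alpha> ^ 3))"
    unfolding Y_def by (simp add: power_mult_distrib power2_eq_square)
  have "(X + Y) * (X - Y) = X\<^sup>2 - Y\<^sup>2"
    by (simp add: power2_eq_square algebra_simps)
  also have "\<dots> = (\<alpha>\<^sup>2) ^ 3"
    unfolding Y2 X_def by (simp add: power2_eq_square power3_eq_cube field_simps)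
  finally have "(p * q) ^ 3 = (\<alpha>\<^sup>2) ^ 3"
    by (simp add: power_mult_distrib p3 q3)
  \<comment> \<open>Cubing is injective on the reals.\<close>
  then have pq: "p * q = \<alpha>\<^sup>2"
    using odd_real_root_power_cancel[of 3] by (metis odd_numeral)
  have "s ^ 3 = p ^ 3 + q ^ 3 + 3 * (p * q) * s"
    unfolding s_def by (simp add: power3_eq_cube algebra_simps)
  then have s3: "s ^ 3 = 2 * X + 3 * \<alpha>\<^sup>2 * s"
    by (simp add: p3 q3 pq)

  \<comment> \<open>For \<open>\<alpha> > 0\<close>, \<open>X\<close> is half the quantity bounded
    by \<delta>, minus \<open>\<alpha> ^ 3\<close>. Otherwise both summands of \<open>X\<close> are
    nonpositive and one is negative.\<close>
  have "X < 0"
  proof (cases "\<alpha> > 0")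
    case True
    then have "\<alpha> ^ 3 > 0" by simp
    then show ?thesis using \<delta> unfolding X_def by linarith
  next
    case False
    have "\<alpha> ^ 3 \<le> 0" "\<alpha> < 0 \<Longrightarrow> \<alpha> ^ 3 < 0"
      using False by (auto simp: power_le_zero_eq power_less_zero_eq)
    then show ?thesis using a unfolding X_def by linarith
  qed
  \<comment> \<open>Since \<open>p\<close> and \<open>q\<close> are real, this discriminant is
    nonnegative. It bounds \<open>s\<close> away from zero in terms of \<alpha>, so that
    \<open>s\<close> inherits the sign of \<open>X\<close>.\<close>
  have "(p - q)\<^sup>2 = s\<^sup>2 - 4 * (p * q)"
    unfolding s_def by (simp add: power2_eq_square algebra_simps)
  then have s2: "4 * \<alpha>\<^sup>2 \<le> s\<^sup>2"
    using pq zero_le_power2[of "p - q"] by simp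
  have "s * (s\<^sup>2 - 3 * \<alpha>\<^sup>2) = 2 * X"
    using s3 by (simp add: power2_eq_square power3_eq_cube algebra_simps)
  then have "s * (s\<^sup>2 - 3 * \<alpha>\<^sup>2) < 0" using \<open>X < 0\<close> by simp
  moreover have "s\<^sup>2 - 3 * \<alpha>\<^sup>2 \<ge> 0" using s2 zero_le_power2[of \<alpha>] by linarith
  ultimately have s: "s < 0" by (simp add: mult_less_0_iff)
  have "\<bar>2 * \<alpha>\<bar> \<le> \<bar>s\<bar>"
    using s2 by (simp add: abs_le_square_iff power_mult_distrib)
  then have "\<alpha> + s < 0" using s by arith
  then show "x > 0" unfolding x by simp

  have "27 * (x ^ 3 + \<alpha> * x\<^sup>2 + a) = 2 * \<alpha> ^ 3 + 3 * \<alpha>\<^sup>2 * s - s ^ 3 + 27 * a"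
    unfolding x by (simp add: power2_eq_square power3_eq_cube field_simps)
  also have "\<dots> = 0" unfolding s3 X_def by simp
  finally show "x ^ 3 + \<alpha> * x\<^sup>2 + a = 0" by simp
qed

lemma xi_c_eqI:
  assumes "U \<in> admissible_set" "x > 0 \<and> f_c U x = 0"
  shows "xi_c U = x"
  unfolding xi_c_def using f_c_unique_pos_root[OF assms(1)] assms(2) by (rule the1_equality)

theorem theorem3p15:
  fixes D E \<alpha>\<^sub>1 a\<^sub>0 \<delta> :: real and m B :: "real ^ 3"
  assumes "(D, m, B, E) \<in> admissible_set"
    and "\<alpha>\<^sub>1 = (norm B)\<^sup>2 - E"
    and "a\<^sub>0 = - (1 / 2) * ((norm B)\<^sup>2 * D\<^sup>2 + (m \<bullet> B)\<^sup>2)"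
    and "\<delta> = 27 * a\<^sub>0 + 4 * \<alpha>\<^sub>1 ^ 3"
  shows "(\<delta> > 0 \<longrightarrow>
            (let \<theta> = arccos (1 + 13.5 * a\<^sub>0 / \<alpha>\<^sub>1 ^ 3)
             in xi_c (D, m, B, E) = - (\<alpha>\<^sub>1 / 3) * (1 - 2 * cos (\<theta> / 3 - pi / 3)))) \<and>
         (\<delta> \<le> 0 \<longrightarrow>
            (let X\<^sub>1 = \<alpha>\<^sub>1 ^ 3 + 13.5 * a\<^sub>0;
                 X\<^sub>2 = 1.5 * sqrt (3 * a\<^sub>0 * \<delta>)
             in xi_c (D, m, B, E) = - (1 / 3) * (\<alpha>\<^sub>1 + root 3 (X\<^sub>1 + X\<^sub>2) + root 3 (X\<^sub>1 - X\<^sub>2))))"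
proof -
  have D: "D > 0" and "E > sqrt (D\<^sup>2 + (norm m)\<^sup>2)"
    using assms(1) unfolding admissible_set_def by auto
  moreover have "sqrt (D\<^sup>2 + (norm m)\<^sup>2) \<ge> 0" by simp
  ultimately have E: "E > 0" by linarith
  \<comment> \<open>The degenerate alternative occurs for \<open>B = 0\<close>, where the cubic is
    \<open>x\<^sup>2 * (x - E)\<close>.\<close>
  have sign: "a\<^sub>0 < 0 \<or> (a\<^sub>0 = 0 \<and> \<alpha>\<^sub>1 < 0)"
  proof (cases "B = 0")
    case True
    then show ?thesis using E assms(2,3) by simp
  next
    case False
    then have "(norm B)\<^sup>2 * D\<^sup>2 > 0" using D by simp
    then have "(norm B)\<^sup>2 * D\<^sup>2 + (m \<bullet> B)\<^sup>2 > 0" by (simp add: add_pos_nonneg)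
    then show ?thesis using assms(3) by simp
  qed
  have xi: "xi_c (D, m, B, E) = x" if "x > 0 \<and> x ^ 3 + \<alpha>\<^sub>1 * x\<^sup>2 + a\<^sub>0 = 0" for x
    using that assms(2,3) by (intro xi_c_eqI[OF assms(1)]) (simp add: algebra_simps)
  have dec: "13.5 = (27 / 2 :: real)" "1.5 = (3 / 2 :: real)" by simp_all
  show ?thesis
  proof (intro conjI impI)
    assume \<delta>: "\<delta> > 0"
    \<comment> \<open>In the degenerate alternative \<delta> would be
      \<open>4 * \<alpha>\<^sub>1 ^ 3 < 0\<close>.\<close>
    have "a\<^sub>0 < 0"
    proof (rule ccontr)
      assume "\<not> a\<^sub>0 < 0"
      then have "a\<^sub>0 = 0" "\<alpha>\<^sub>1 ^ 3 < 0" using sign by (auto simp: power_less_zero_eq)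
      then show False using \<delta> assms(4) by simp
    qed
    then show "let \<theta> = arccos (1 + 13.5 * a\<^sub>0 / \<alpha>\<^sub>1 ^ 3)
        in xi_c (D, m, B, E) = - (\<alpha>\<^sub>1 / 3) * (1 - 2 * cos (\<theta> / 3 - pi / 3))"
      using \<delta> unfolding Let_def dec assms(4) by (intro xi cubic_trigonometric_root)
  next
    assume "\<delta> \<le> 0"
    then show "let X\<^sub>1 = \<alpha>\<^sub>1 ^ 3 + 13.5 * a\<^sub>0; X\<^sub>2 = 1.5 * sqrt (3 * a\<^sub>0 * \<delta>)
        in xi_c (D, m, B, E) = - (1 / 3) * (\<alpha>\<^sub>1 + root 3 (X\<^sub>1 + X\<^sub>2) + root 3 (X\<^sub>1 - X\<^sub>2))"
      using sign unfolding Let_def dec assms(4) by (intro xi cubic_cardano_root)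
  qed
qed

end
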